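(* (Norm compression inequality) Let $A$ be any real $p\times p$ matrix and let $p_1,p_2,\dots,p_G$ be positive integers with $p_1+\cdots+p_G=p$. Partition $A$ into blocks $A=(A_{ij})_{1\le i,j\le G}$, where $A_{ij}$ is the $p_i\times p_j$ submatrix in block row $i$ and block column $j$, and let $\mathcal{N}(A;p_1,\dots,p_G)$ be the $G\times G$ matrix whose $(i,j)$ entry is $\|A_{ij}\|$. Then $$\|A\|\le\|\mathcal{N}(A;p_1,\dots,p_G)\|.$$
   Context: $\|\cdot\|$ denotes the spectral norm (the operator norm induced by the Euclidean norm). *)

theory Defs
  imports "Jordan_Normal_Form.DL_Submatrix" "HOL-Analysis.L2_Norm"
begin

definition eucl_norm :: "real vec \<Rightarrow> real" where
  "eucl_norm v = L2_set (\<lambda>i. v $ i) {..<dim_vec v}"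

(* Operator norm induced by the Euclidean norm, in the form of the library's onorm:
   the zero vector contributes 0 / 0 = 0, so that the set is nonempty even when A has
   no columns. *)
definition spectral_norm :: "real mat \<Rightarrow> real" where
  "spectral_norm A =
     (SUP x\<in>carrier_vec (dim_col A). eucl_norm (A *\<^sub>v x) / eucl_norm x)"

(* Index set of the i-th block for block sizes ps 0, ps 1, ...; indices start at 0. *)
definition block_range :: "(nat \<Rightarrow> nat) \<Rightarrow> nat \<Rightarrow> nat set" where
  "block_range ps i = {(\<Sum>k<i. ps k)..<(\<Sum>k<Suc i. ps k)}"

definition block :: "real mat \<Rightarrow> (nat \<Rightarrow> nat) \<Rightarrow> nat \<Rightarrow> nat \<Rightarrow> real mat" where
  "block A ps i j = submatrix A (block_range ps i) (block_range ps j)"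

definition norm_compression :: "real mat \<Rightarrow> nat \<Rightarrow> (nat \<Rightarrow> nat) \<Rightarrow> real mat" where
  "norm_compression A G ps = mat G G (\<lambda>(i, j). spectral_norm (block A ps i j))"

lemma pick_interval: "r < b - a \<Longrightarrow> pick {a..<b} r = a + r"
proof (induction r)
  case 0
  then show ?case by (auto intro!: Least_equality)
next
  case (Suc r)
  then show ?case by (auto intro!: Least_equality)
qed

lemma block_in_carrier_and_index:
  assumes "A \<in> carrier_mat p p" "(\<Sum>i<G. ps i) = p" "i < G" "j < G"
  shows "block A ps i j \<in> carrier_mat (ps i) (ps j)"
    and "\<And>r s. r < ps i \<Longrightarrow> s < ps j \<Longrightarrow>
           block A ps i j $$ (r, s) = A $$ ((\<Sum>k<i. ps k) + r, (\<Sum>k<j. ps k) + s)"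
proof -
  have card: "card {l. l < p \<and> l \<in> block_range ps k} = ps k" if "k < G" for k
  proof -
    have "(\<Sum>l<Suc k. ps l) \<le> p"
      unfolding assms(2)[symmetric] using that by (intro sum_mono2) auto
    then have "{l. l < p \<and> l \<in> block_range ps k} = block_range ps k"
      by (auto simp: block_range_def)
    then show ?thesis by (simp add: block_range_def)
  qed
  note c = card[OF assms(3)] card[OF assms(4)]
  show "block A ps i j \<in> carrier_mat (ps i) (ps j)"
    using assms(1) c by (auto simp: block_def submatrix_def)
  show "block A ps i j $$ (r, s) = A $$ ((\<Sum>k<i. ps k) + r, (\<Sum>k<j. ps k) + s)"
    if "r < ps i" "s < ps j" for r s
    using assms(1) c that by (simp add: block_def submatrix_def block_range_def pick_interval)
qed

(* The supremum of reals in spectral_norm is taken over a bounded set, hence genuine. *)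
lemma bdd_above_spectral_norm:
  "bdd_above ((\<lambda>x. eucl_norm (A *\<^sub>v x) / eucl_norm x) ` carrier_vec (dim_col A))"
proof (rule bdd_aboveI2)
  fix x :: "real vec" assume x: "x \<in> carrier_vec (dim_col A)"
  let ?C = "\<Sum>i<dim_row A. \<Sum>j<dim_col A. \<bar>A $$ (i, j)\<bar>"
  have C: "0 \<le> ?C" by (intro sum_nonneg) auto
  have xj: "\<bar>x $ j\<bar> \<le> eucl_norm x" if "j < dim_col A" for j
  proof -
    have "\<bar>x $ j\<bar> \<le> L2_set (\<lambda>i. \<bar>x $ i\<bar>) {..<dim_vec x}"
      using that x by (intro member_le_L2_set) auto
    then show ?thesis by (simp add: eucl_norm_def L2_set_def)
  qed
  have "eucl_norm (A *\<^sub>v x) \<le> (\<Sum>i<dim_row A. \<bar>(A *\<^sub>v x) $ i\<bar>)"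
    unfolding eucl_norm_def by (rule order_trans[OF L2_set_le_sum_abs]) simp
  also have "\<dots> \<le> (\<Sum>i<dim_row A. \<Sum>j<dim_col A. \<bar>A $$ (i, j)\<bar> * eucl_norm x)"
  proof (rule sum_mono)
    fix i assume i: "i \<in> {..<dim_row A}"
    have "(A *\<^sub>v x) $ i = (\<Sum>j<dim_col A. A $$ (i, j) * x $ j)"
      using i x by (auto simp: scalar_prod_def atLeast0LessThan intro!: sum.cong)
    also have "\<bar>\<dots>\<bar> \<le> (\<Sum>j<dim_col A. \<bar>A $$ (i, j) * x $ j\<bar>)" by (rule sum_abs)
    also have "\<dots> \<le> (\<Sum>j<dim_col A. \<bar>A $$ (i, j)\<bar> * eucl_norm x)"
      using xj by (intro sum_mono) (auto simp: abs_mult intro!: mult_left_mono)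
    finally show "\<bar>(A *\<^sub>v x) $ i\<bar> \<le> (\<Sum>j<dim_col A. \<bar>A $$ (i, j)\<bar> * eucl_norm x)" .
  qed
  also have "\<dots> = ?C * eucl_norm x" by (simp add: sum_distrib_right)
  finally have le: "eucl_norm (A *\<^sub>v x) \<le> ?C * eucl_norm x" .
  have "0 \<le> eucl_norm x" by (simp add: eucl_norm_def)
  then show "eucl_norm (A *\<^sub>v x) / eucl_norm x \<le> ?C"
    using le C by (cases "eucl_norm x = 0") (auto simp: divide_le_eq)
qed

end

theory Submission
  imports Defs
begin

text \<open>
  Cut a vector \<open>x\<close> into blocks \<open>x\<^sub>j\<close> conforming to the partition, and let \<open>X\<close> be the vector of
  the block norms, so that \<open>X\<close> and \<open>x\<close> have the same Euclidean norm.
  By the triangle inequality the \<open>i\<close>-th block of \<open>A x\<close> has norm at most the sum over \<open>j\<close> of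
  the products of the norms of \<open>A\<^sub>i\<^sub>j\<close> and \<open>x\<^sub>j\<close>, which is the \<open>i\<close>-th entry of \<open>N X\<close> for the
  compression \<open>N\<close>. Hence \<open>A x\<close> is no longer than \<open>N X\<close>, whose length is at most the norm of
  \<open>N\<close> times that of \<open>x\<close>.
\<close>

lemma eucl_norm_nonneg: "0 \<le> eucl_norm v"
  by (simp add: eucl_norm_def)

lemma eucl_norm_zero_vec: "eucl_norm (0\<^sub>v n) = 0"
  by (simp add: eucl_norm_def L2_set_def)

lemma eucl_norm_vec: "eucl_norm (vec n f) = L2_set f {..<n}"
  by (simp add: eucl_norm_def L2_set_def)

lemma eucl_norm_eq_0D: "eucl_norm v = 0 \<Longrightarrow> v = 0\<^sub>v (dim_vec v)"
  by (auto simp: eucl_norm_def L2_set_eq_0_iff)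

text \<open>The zero vector contributes the quotient 0 / 0 = 0 to a set that is bounded
  above.\<close>

lemma spectral_norm_nonneg: "0 \<le> spectral_norm A"
  unfolding spectral_norm_def
  by (rule cSUP_upper2[OF bdd_above_spectral_norm zero_carrier_vec])
    (simp add: eucl_norm_zero_vec)

lemma eucl_norm_mult_mat_vec_le:
  assumes "x \<in> carrier_vec (dim_col A)"
  shows "eucl_norm (A *\<^sub>v x) \<le> spectral_norm A * eucl_norm x"
proof (cases "eucl_norm x = 0")
  \<comment> \<open>Division by zero yields 0, so the supremum says nothing about the image of
    \<open>x\<close> here; instead \<open>x\<close> itself must be zero.\<close>
  case True
  then have "x = 0\<^sub>v (dim_col A)"
    using eucl_norm_eq_0D assms by fastforce
  then have "A *\<^sub>v x = 0\<^sub>v (dim_row A)"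
    by auto
  then show ?thesis
    using True by (simp add: eucl_norm_zero_vec)
next
  case False
  have "eucl_norm (A *\<^sub>v x) / eucl_norm x \<le> spectral_norm A"
    unfolding spectral_norm_def by (rule cSUP_upper[OF assms bdd_above_spectral_norm])
  then show ?thesis
    using False eucl_norm_nonneg[of x] by (simp add: divide_le_eq)
qed

text \<open>The condition \<open>0 \<le> c\<close> covers the quotient at the zero vector, which is
  0 by convention.\<close>

lemma spectral_norm_leI:
  assumes "0 \<le> c"
    and "\<And>x. x \<in> carrier_vec (dim_col A) \<Longrightarrow> eucl_norm (A *\<^sub>v x) \<le> c * eucl_norm x"
  shows "spectral_norm A \<le> c"
  unfolding spectral_norm_def
proof (rule cSUP_least)
  show "carrier_vec (dim_col A) \<noteq> ({} :: real vec set)"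
    using zero_carrier_vec by blast
next
  fix x :: "real vec" assume "x \<in> carrier_vec (dim_col A)"
  then show "eucl_norm (A *\<^sub>v x) / eucl_norm x \<le> c"
    using assms eucl_norm_nonneg[of x]
    by (cases "eucl_norm x = 0") (auto simp: divide_le_eq)
qed

text \<open>Minkowski's inequality, iterated over \<open>J\<close>; for infinite \<open>J\<close>
  both sides are 0.\<close>

lemma L2_set_sum_le: "L2_set (\<lambda>r. \<Sum>j\<in>J. f j r) S \<le> (\<Sum>j\<in>J. L2_set (f j) S)"
proof (induction J rule: infinite_finite_induct)
  case (insert j J)
  then show ?case
    using L2_set_triangle_ineq[of "f j" "\<lambda>r. \<Sum>j\<in>J. f j r" S] by simp
qed (simp_all add: L2_set_def)

lemma sum_lessThan_add:
  fixes f :: "nat \<Rightarrow> 'a::comm_monoid_add"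
  shows "(\<Sum>k<m + n. f k) = (\<Sum>k<m. f k) + (\<Sum>r<n. f (m + r))"
  by (induction n) (simp_all add: add.assoc)

text \<open>Induction on \<open>G\<close> splits off the last block, which starts where the earlier
  sizes add up to.\<close>

lemma sum_lessThan_blocks:
  fixes f :: "nat \<Rightarrow> 'a::comm_monoid_add" and ps :: "nat \<Rightarrow> nat"
  shows "(\<Sum>k<(\<Sum>i<G. ps i). f k) = (\<Sum>i<G. \<Sum>r<ps i. f ((\<Sum>k<i. ps k) + r))"
  by (induction G) (simp_all add: sum_lessThan_add)

text \<open>Squaring the inner norms removes their roots, which leaves the sum of squares regrouped
  by blocks.\<close>

lemma L2_set_lessThan_blocks:
  fixes ps :: "nat \<Rightarrow> nat"
  shows "L2_set f {..<(\<Sum>i<G. ps i)} =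
    L2_set (\<lambda>i. L2_set (\<lambda>r. f ((\<Sum>k<i. ps k) + r)) {..<ps i}) {..<G}"
  by (simp add: L2_set_def sum_lessThan_blocks sum_nonneg)

lemma block_index_less:
  fixes ps :: "nat \<Rightarrow> nat"
  assumes "i < G" "r < ps i"
  shows "(\<Sum>k<i. ps k) + r < (\<Sum>k<G. ps k)"
proof -
  have "(\<Sum>k<i. ps k) + r < (\<Sum>k<Suc i. ps k)"
    using assms by simp
  also have "\<dots> \<le> (\<Sum>k<G. ps k)"
    using assms by (intro sum_mono2) auto
  finally show ?thesis .
qed

text \<open>The offset is the lower end of \<open>block_range ps j\<close>, so the entries line up
  with the columns of \<open>block A ps i j\<close>.\<close>

definition vec_block :: "'a vec \<Rightarrow> (nat \<Rightarrow> nat) \<Rightarrow> nat \<Rightarrow> 'a vec" where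
  "vec_block x ps j = vec (ps j) (\<lambda>s. x $ ((\<Sum>k<j. ps k) + s))"

lemma dim_vec_block [simp]: "dim_vec (vec_block x ps j) = ps j"
  by (simp add: vec_block_def)

lemma eucl_norm_vec_blocks:
  assumes "x \<in> carrier_vec (\<Sum>i<G. ps i)"
  shows "eucl_norm x = eucl_norm (vec G (\<lambda>j. eucl_norm (vec_block x ps j)))"
  using assms
  by (auto simp: eucl_norm_def vec_block_def L2_set_lessThan_blocks intro!: L2_set_cong)

text \<open>Block multiplication: the sum over all columns in one row of the product is regrouped by
  column blocks.\<close>

lemma mult_mat_vec_blocks:
  assumes A: "A \<in> carrier_mat p p" and p: "(\<Sum>i<G. ps i) = p"
    and x: "x \<in> carrier_vec p" and i: "i < G" and r: "r < ps i"
  shows "vec_block (A *\<^sub>v x) ps i $ r = (\<Sum>j<G. (block A ps i j *\<^sub>v vec_block x ps j) $ r)"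
proof -
  let ?o = "\<lambda>i. \<Sum>k<i. ps k"
  have "?o i + r < p"
    using block_index_less[of i G r ps] i r p by simp
  then have "vec_block (A *\<^sub>v x) ps i $ r = (\<Sum>l<p. A $$ (?o i + r, l) * x $ l)"
    using A x r by (auto simp: vec_block_def scalar_prod_def atLeast0LessThan intro!: sum.cong)
  also have "\<dots> = (\<Sum>j<G. \<Sum>s<ps j. A $$ (?o i + r, ?o j + s) * x $ (?o j + s))"
    unfolding p[symmetric] by (rule sum_lessThan_blocks)
  also have "\<dots> = (\<Sum>j<G. (block A ps i j *\<^sub>v vec_block x ps j) $ r)"
  proof (rule sum.cong[OF refl])
    fix j assume "j \<in> {..<G}"
    then have j: "j < G" by simp
    note block = block_in_carrier_and_index[OF A p i j]
    show "(\<Sum>s<ps j. A $$ (?o i + r, ?o j + s) * x $ (?o j + s)) =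
        (block A ps i j *\<^sub>v vec_block x ps j) $ r"
      using block r
      by (auto simp: vec_block_def scalar_prod_def atLeast0LessThan intro!: sum.cong)
  qed
  finally show ?thesis .
qed

theorem theorem3p4:
  fixes A :: "real mat" and p G :: nat and ps :: "nat \<Rightarrow> nat"
  assumes "A \<in> carrier_mat p p"
    and "\<And>i. i < G \<Longrightarrow> 0 < ps i"
    and "(\<Sum>i<G. ps i) = p"
  shows "spectral_norm A \<le> spectral_norm (norm_compression A G ps)"
proof (rule spectral_norm_leI[OF spectral_norm_nonneg])
  fix x :: "real vec" assume "x \<in> carrier_vec (dim_col A)"
  then have x: "x \<in> carrier_vec p" using assms(1) by simp
  let ?N = "norm_compression A G ps"
  define X where "X = vec G (\<lambda>j. eucl_norm (vec_block x ps j))"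
  have le: "eucl_norm (vec_block (A *\<^sub>v x) ps i) \<le> (?N *\<^sub>v X) $ i" if i: "i < G" for i
  proof -
    have "eucl_norm (vec_block (A *\<^sub>v x) ps i) =
        L2_set (\<lambda>r. \<Sum>j<G. (block A ps i j *\<^sub>v vec_block x ps j) $ r) {..<ps i}"
      unfolding eucl_norm_def dim_vec_block
      by (rule L2_set_cong) (simp_all add: mult_mat_vec_blocks[OF assms(1,3) x i])
    also have "\<dots> \<le> (\<Sum>j<G. L2_set (\<lambda>r. (block A ps i j *\<^sub>v vec_block x ps j) $ r) {..<ps i})"
      by (rule L2_set_sum_le)
    also have "\<dots> \<le> (\<Sum>j<G. spectral_norm (block A ps i j) * eucl_norm (vec_block x ps j))"
    proof (rule sum_mono)
      fix j assume "j \<in> {..<G}"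
      then have "block A ps i j \<in> carrier_mat (ps i) (ps j)"
        using block_in_carrier_and_index(1)[OF assms(1,3) i] by blast
      then have rows: "dim_row (block A ps i j) = ps i" and cols: "dim_col (block A ps i j) = ps j"
        by (rule carrier_matD)+
      have "vec_block x ps j \<in> carrier_vec (dim_col (block A ps i j))"
        unfolding cols by (rule carrier_vecI) (rule dim_vec_block)
      note eucl_norm_mult_mat_vec_le[OF this]
      then show "L2_set (\<lambda>r. (block A ps i j *\<^sub>v vec_block x ps j) $ r) {..<ps i} \<le>
          spectral_norm (block A ps i j) * eucl_norm (vec_block x ps j)"
        unfolding eucl_norm_def[of "block A ps i j *\<^sub>v vec_block x ps j"] dim_mult_mat_vec rows .
    qed
    \<comment> \<open>The bound is the product of row \<open>i\<close> of the compression with the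
      vector of block norms.\<close>
    also have "\<dots> = (?N *\<^sub>v X) $ i"
      using i by (simp add: norm_compression_def X_def scalar_prod_def atLeast0LessThan)
    finally show ?thesis .
  qed
  have "eucl_norm (A *\<^sub>v x) = eucl_norm (vec G (\<lambda>i. eucl_norm (vec_block (A *\<^sub>v x) ps i)))"
    by (rule eucl_norm_vec_blocks) (use assms(1,3) x in simp)
  also have "\<dots> = L2_set (\<lambda>i. eucl_norm (vec_block (A *\<^sub>v x) ps i)) {..<G}"
    by (rule eucl_norm_vec)
  also have "\<dots> \<le> L2_set (\<lambda>i. (?N *\<^sub>v X) $ i) {..<G}"
    \<comment> \<open>Entrywise comparison passes to Euclidean norms because the smaller entries are
      nonnegative.\<close>
    by (rule L2_set_mono) (simp_all add: le eucl_norm_nonneg)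
  also have "\<dots> = eucl_norm (?N *\<^sub>v X)"
    by (simp add: eucl_norm_def norm_compression_def)
  also have "\<dots> \<le> spectral_norm ?N * eucl_norm X"
    by (rule eucl_norm_mult_mat_vec_le) (simp add: X_def norm_compression_def)
  also have "eucl_norm X = eucl_norm x"
    unfolding X_def using x assms(3) by (intro eucl_norm_vec_blocks[symmetric]) simp
  finally show "eucl_norm (A *\<^sub>v x) \<le> spectral_norm ?N * eucl_norm x" .
qed

end
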